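(* Consider the i-C&CG algorithm (described in the context) applied to the two-stage robust problem $\upsilon^\star=\min_{x\in\mathcal X}\{c^\top x+\max_{\xi\in\Xi}\min_{y\in\mathcal Y(x,\xi)}q^\top y\}$ under the standing assumptions listed in the context. Suppose the algorithm reaches the exploitation step at iteration $j$, i.e., in Step 3 the actual relative gap satisfies $(\overline U-L^\ell)/\overline U\ge\varepsilon$ but the inexact relative gap satisfies $(\overline U-U^j)/\overline U<\widetilde\varepsilon$. Then the actual relative gap satisfies $$\frac{\overline U-L^\ell}{\overline U}\ \le\ \frac{1}{1-\widetilde\varepsilon}\prod_{k=\ell}^{j}\frac{1}{1-\varepsilon_{MP}^k}-1,$$ where $\overline U,L^\ell,U^j,\ell$ and $\varepsilon_{MP}^k$ denote the values current when Step 3 is entered (before the reduction of the $\varepsilon_{MP}^k$ by that exploitation step).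
   Context: Problem. $x\in\mathbb R^n$ are first-stage variables with feasible set $\mathcal X\subseteq\mathbb R^n$; $\Xi\subseteq\mathbb R^l$ is the uncertainty set; $\mathcal Y(x,\xi)=\{y\in\mathbb R^m_+ : Tx+Wy+C\xi\ge h\}$ is the second-stage feasible set (some components of $x$ and $y$ may be required to be integer); $c,q,h,T,W,C$ are known vectors/matrices of compatible sizes. Write $Q(x,\xi)=\min_{y\in\mathcal Y(x,\xi)}q^\top y$. Standing assumptions. (i) $\Xi$ is a nonempty finite set or a polytope. (ii) $\mathcal Y(x,\xi)\neq\emptyset$ for all $x\in\mathcal X,\xi\in\Xi$. (iii) The problem has an optimal solution $x^\star$ with finite optimal value $\upsilon^\star$. (iv) There is $K>0$ with $c^\top x+Q(x,\xi)\ge K$ for all $x\in\mathcal X,\xi\in\Xi$. (v) For each $x\in\mathcal X$ an oracle solves $\max_{\xi\in\Xi}Q(x,\xi)$ exactly, returning an optimal $\xi^\star$, which is an extreme point of $\Xi$ when $\Xi$ is a polytope. i-C&CG algorithm. Parameters: $\varepsilon\in[0,1]$, $\widetilde\varepsilon\in(0,\varepsilon/(1+\varepsilon))$, $\varepsilon_{MP}^j\in(0,1)$ for $j\in\mathbb N$, $\alpha\in(0,1)$. Initialize $\overline L\gets0$, $\overline U\gets\infty$, $\mathcal S\gets\emptyset$, $j\gets1$, $\ell\gets0$, with the convention $L^0=0$. Step 1.1. Solve, to within relative optimality gap $\varepsilon_{MP}^j$, the master problem $$\upsilon_j^\star=\min_{x\in\mathcal X,\ \delta\in\mathbb R}\ c^\top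 x+\delta\quad\text{s.t.}\quad \delta\ge Q(x,\xi)\ \ \forall\xi\in\mathcal S,\qquad c^\top x+\delta\ge\overline L,$$ and record the best feasible solution found, $(x^j,\delta^j)$. Step 1.2. Record a lower bound $L^j\ge\overline L$ on $\upsilon_j^\star$ and the upper bound $U^j=c^\top x^j+\delta^j$ of $\upsilon_j^\star$ (overwriting earlier values with index $j$); the gap requirement means $U^j-L^j\le\varepsilon_{MP}^jU^j$. If $L^j>\overline L$, set $\ell\gets j$. Step 1.3. Set $\overline L\gets U^j$. Step 2. Compute $D^j=\max_{\xi\in\Xi}Q(x^j,\xi)$ with the oracle, obtaining an optimal $\xi^\star$, and set $\overline U\gets\min\{\overline U,\ c^\top x^j+D^j\}$. Step 3. If $(\overline U-L^\ell)/\overline U<\varepsilon$, terminate and return $x^j$. Otherwise: (Exploitation) if $(\overline U-U^j)/\overline U<\widetilde\varepsilon$, set $j\gets\ell$, $\overline L\gets L^\ell$, replace $\varepsilon_{MP}^k$ by $\alpha\varepsilon_{MP}^k$ for all $k\ge\ell$, and go to Step 1 (the set $\mathcal S$ is kept); (Exploration) if $(\overline U-U^j)/\overline U\ge\widetilde\varepsilon$, go to Step 4. Step 4. Set $\mathcal S\gets\mathcal S\cup\{\xi^\star\}$, $j\gets j+1$, and go to Step 1. The quantity $(\overline U-L^\ell)/\overline U$ is called the actual relative gap and $(\overline U-U^j)/\overline U$ the inexact relative gap. *)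

theory Defs
  imports "HOL-Analysis.Analysis"
begin

text \<open>
  Integrality requirements on first-stage variables are part of the arbitrary set \<open>feas\<close>;
  \<open>int_idx\<close> lists the components of the second-stage variables that must be integer.
\<close>

record ('n, 'm, 'l, 'r) problem =
  feas    :: "(real^'n) set"
  unc     :: "(real^'l) set"
  cost1   :: "real^'n"
  cost2   :: "real^'m"
  rhs     :: "real^'r"
  Tmat    :: "real^'n^'r"
  Wmat    :: "real^'m^'r"
  Cmat    :: "real^'l^'r"
  int_idx :: "'m set"

definition second_stage ::
  "('n::finite, 'm::finite, 'l::finite, 'r::finite) problem \<Rightarrow> real^'n \<Rightarrow> real^'l \<Rightarrow> (real^'m) set"
where
  "second_stage P x \<xi> =
     {y. 0 \<le> y \<and> (\<forall>i\<in>int_idx P. y $ i \<in> \<int>) \<and>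
         rhs P \<le> Tmat P *v x + Wmat P *v y + Cmat P *v \<xi>}"

text \<open>
  Optimal values are taken in the extended reals: an infeasible minimisation problem has value
  \<open>\<infinity>\<close>, an unbounded one \<open>-\<infinity>\<close>, and otherwise the infimum is the minimum whenever
  the latter is attained.
\<close>

definition recourse ::
  "('n::finite, 'm::finite, 'l::finite, 'r::finite) problem \<Rightarrow> real^'n \<Rightarrow> real^'l \<Rightarrow> ereal"
where
  "recourse P x \<xi> = (INF y\<in>second_stage P x \<xi>. ereal (cost2 P \<bullet> y))"

definition worst_case ::
  "('n::finite, 'm::finite, 'l::finite, 'r::finite) problem \<Rightarrow> real^'n \<Rightarrow> ereal"
where
  "worst_case P x = (SUP \<xi>\<in>unc P. recourse P x \<xi>)"

definition opt_value :: "('n::finite, 'm::finite, 'l::finite, 'r::finite) problem \<Rightarrow> ereal"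
where
  "opt_value P = (INF x\<in>feas P. ereal (cost1 P \<bullet> x) + worst_case P x)"

definition oracle_answer ::
  "('n::finite, 'm::finite, 'l::finite, 'r::finite) problem \<Rightarrow> real^'n \<Rightarrow> real^'l \<Rightarrow> bool"
where
  "oracle_answer P x \<xi> \<longleftrightarrow>
     \<xi> \<in> unc P \<and> (\<forall>\<xi>'\<in>unc P. recourse P x \<xi>' \<le> recourse P x \<xi>) \<and>
     (polytope (unc P) \<longrightarrow> \<xi> extreme_point_of unc P)"

definition standing_assumptions ::
  "('n::finite, 'm::finite, 'l::finite, 'r::finite) problem \<Rightarrow> bool"
where
  "standing_assumptions P \<longleftrightarrow>
     unc P \<noteq> {} \<and> (finite (unc P) \<or> polytope (unc P)) \<and>
     (\<forall>x\<in>feas P. \<forall>\<xi>\<in>unc P. second_stage P x \<xi> \<noteq> {}) \<and>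
     \<bar>opt_value P\<bar> \<noteq> \<infinity> \<and>
     (\<exists>x\<in>feas P. ereal (cost1 P \<bullet> x) + worst_case P x = opt_value P) \<and>
     (\<exists>K>0. \<forall>x\<in>feas P. \<forall>\<xi>\<in>unc P. ereal K \<le> ereal (cost1 P \<bullet> x) + recourse P x \<xi>) \<and>
     (\<forall>x\<in>feas P. \<exists>\<xi>. oracle_answer P x \<xi>)"

record params =
  tol      :: real                \<comment> \<open>\<open>\<epsilon>\<close>\<close>
  inex_tol :: real                \<comment> \<open>tolerance \<open>\<epsilon>\<close>-tilde on the inexact gap\<close>
  mp_init  :: "nat \<Rightarrow> real"    \<comment> \<open>initial master gaps\<close>
  shrink   :: real                \<comment> \<open>\<open>\<alpha>\<close>\<close>

definition valid_params :: "params \<Rightarrow> bool"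
where
  "valid_params A \<longleftrightarrow>
     tol A \<in> {0..1} \<and> inex_tol A \<in> {0<..<tol A / (1 + tol A)} \<and>
     (\<forall>k. mp_init A k \<in> {0<..<1}) \<and> shrink A \<in> {0<..<1}"

record ('n, 'l) state =
  lbar   :: real
  ubar   :: ereal
  scen   :: "(real^'l) set"
  iter   :: nat                   \<comment> \<open>\<open>j\<close>\<close>
  lidx   :: nat                   \<comment> \<open>\<open>\<ell>\<close>\<close>
  mp_gap :: "nat \<Rightarrow> real"
  xrec   :: "nat \<Rightarrow> real^'n"
  drec   :: "nat \<Rightarrow> real"      \<comment> \<open>\<open>\<delta>\<^sup>j\<close>\<close>
  lrec   :: "nat \<Rightarrow> real"      \<comment> \<open>\<open>L\<^sup>j\<close>\<close>
  urec   :: "nat \<Rightarrow> real"      \<comment> \<open>\<open>U\<^sup>j\<close>\<close>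
  xistar :: "real^'l"

definition master_feasible ::
  "('n::finite, 'm::finite, 'l::finite, 'r::finite) problem \<Rightarrow> (real^'l) set \<Rightarrow> real \<Rightarrow>
   ((real^'n) \<times> real) set"
where
  "master_feasible P S b =
     {(x, \<delta>). x \<in> feas P \<and> (\<forall>\<xi>\<in>S. recourse P x \<xi> \<le> ereal \<delta>) \<and> b \<le> cost1 P \<bullet> x + \<delta>}"

definition master_value ::
  "('n::finite, 'm::finite, 'l::finite, 'r::finite) problem \<Rightarrow> (real^'l) set \<Rightarrow> real \<Rightarrow> ereal"
where
  "master_value P S b = (INF (x, \<delta>)\<in>master_feasible P S b. ereal (cost1 P \<bullet> x + \<delta>))"

definition actual_gap :: "('n::finite, 'l::finite) state \<Rightarrow> ereal"
where
  "actual_gap s = (ubar s - ereal (lrec s (lidx s))) / ubar s"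

definition inexact_gap :: "('n::finite, 'l::finite) state \<Rightarrow> ereal"
where
  "inexact_gap s = (ubar s - ereal (urec s (iter s))) / ubar s"

datatype location = Step1 | Step2 | Step3 | Step4 | Returned

text \<open>
  \<open>reaches P A loc s\<close>: some run of the algorithm arrives at \<open>loc\<close> with current values \<open>s\<close>.
  The inexact master solver and the oracle are nondeterministic; records that have not been
  written yet hold arbitrary values, apart from the convention \<open>L\<^sup>0 = 0\<close>.
\<close>

inductive reaches ::
  "('n::finite, 'm::finite, 'l::finite, 'r::finite) problem \<Rightarrow> params \<Rightarrow> location \<Rightarrow>
   ('n, 'l) state \<Rightarrow> bool"
  for P :: "('n, 'm, 'l, 'r) problem" and A :: params
where
  init:
    "\<lbrakk>lbar s = 0; ubar s = \<infinity>; scen s = {}; iter s = 1; lidx s = 0;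
      mp_gap s = mp_init A; lrec s 0 = 0\<rbrakk>
     \<Longrightarrow> reaches P A Step1 s"
| solve_master:
    "\<lbrakk>reaches P A Step1 s;
      (x, \<delta>) \<in> master_feasible P (scen s) (lbar s);
      Uj = cost1 P \<bullet> x + \<delta>;
      lbar s \<le> Lj; ereal Lj \<le> master_value P (scen s) (lbar s);
      Uj - Lj \<le> mp_gap s (iter s) * Uj\<rbrakk>
     \<Longrightarrow> reaches P A Step2
           (s\<lparr>xrec := (xrec s)(iter s := x),
              drec := (drec s)(iter s := \<delta>),
              lrec := (lrec s)(iter s := Lj),
              urec := (urec s)(iter s := Uj),
              lidx := (if lbar s < Lj then iter s else lidx s),
              lbar := Uj\<rparr>)"
| call_oracle:
    "\<lbrakk>reaches P A Step2 s; oracle_answer P (xrec s (iter s)) \<xi>\<rbrakk>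
     \<Longrightarrow> reaches P A Step3
           (s\<lparr>xistar := \<xi>,
              ubar := min (ubar s)
                (ereal (cost1 P \<bullet> xrec s (iter s)) + worst_case P (xrec s (iter s)))\<rparr>)"
| terminate:
    "\<lbrakk>reaches P A Step3 s; actual_gap s < ereal (tol A)\<rbrakk>
     \<Longrightarrow> reaches P A Returned s"
| exploit:
    "\<lbrakk>reaches P A Step3 s; ereal (tol A) \<le> actual_gap s;
      inexact_gap s < ereal (inex_tol A)\<rbrakk>
     \<Longrightarrow> reaches P A Step1
           (s\<lparr>iter := lidx s,
              lbar := lrec s (lidx s),
              mp_gap := (\<lambda>k. if lidx s \<le> k then shrink A * mp_gap s k else mp_gap s k)\<rparr>)"
| explore:
    "\<lbrakk>reaches P A Step3 s; ereal (tol A) \<le> actual_gap s;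
      ereal (inex_tol A) \<le> inexact_gap s\<rbrakk>
     \<Longrightarrow> reaches P A Step4 s"
| add_scenario:
    "reaches P A Step4 s
     \<Longrightarrow> reaches P A Step1 (s\<lparr>scen := insert (xistar s) (scen s), iter := iter s + 1\<rparr>)"

end

theory Submission
  imports Defs
begin

text \<open>
  For \<open>k > \<ell>\<close> the recorded lower bound was not improved, so \<open>L\<^sup>k = U\<^sup>k\<^sup>-\<^sup>1\<close> and the master gap
  requirement reads \<open>(1 - \<epsilon>\<^sup>k) U\<^sup>k \<le> U\<^sup>k\<^sup>-\<^sup>1\<close>, while \<open>(1 - \<epsilon>\<^sup>\<ell>) U\<^sup>\<ell> \<le> L\<^sup>\<ell>\<close>. Chaining these
  bounds \<open>U\<^sup>j\<close> by \<open>L\<^sup>\<ell>\<close> times the product; an exploitation step restarts the chain at \<open>\<ell>\<close>.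
  A small inexact gap bounds the upper bound \<open>u\<close> by \<open>U\<^sup>j / (1 - \<epsilon>)\<close> with the inexact tolerance
  \<open>\<epsilon>\<close>, and \<open>1 - L/u \<le> u/L - 1\<close> finishes the proof.
\<close>

lemma reaches_mp_gap:
  assumes "valid_params A" and "reaches P A loc s"
  shows "0 < mp_gap s k \<and> mp_gap s k < 1"
  using assms(2)
proof (induction arbitrary: k rule: reaches.induct)
  case (init s)
  then show ?case using assms(1) by (simp add: valid_params_def)
next
  case (exploit s)
  have "0 < shrink A" "shrink A < 1"
    using assms(1) by (auto simp: valid_params_def)
  then have "0 < shrink A * mp_gap s k \<and> shrink A * mp_gap s k < 1"
    using exploit.IH[of k] mult_strict_mono[of "shrink A" 1 "mp_gap s k" 1] by simp
  then show ?case using exploit.IH[of k] by simp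
qed simp_all

lemma reaches_feasible:
  assumes "reaches P A loc s" and "loc = Step2"
  shows "xrec s (iter s) \<in> feas P"
  using assms by cases (auto simp: master_feasible_def)

lemma worst_case_pos:
  assumes "standing_assumptions P" and "x \<in> feas P"
  shows "0 < ereal (cost1 P \<bullet> x) + worst_case P x"
proof -
  obtain K where "K > 0" and K: "\<forall>x\<in>feas P. \<forall>\<xi>\<in>unc P. ereal K \<le> ereal (cost1 P \<bullet> x) + recourse P x \<xi>"
    using assms(1) unfolding standing_assumptions_def by blast
  obtain \<xi> where \<xi>: "\<xi> \<in> unc P"
    using assms(1) unfolding standing_assumptions_def by blast
  have "0 < ereal K" using \<open>K > 0\<close> by simp
  also have "\<dots> \<le> ereal (cost1 P \<bullet> x) + recourse P x \<xi>"
    using K assms(2) \<xi> by blast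
  also have "\<dots> \<le> ereal (cost1 P \<bullet> x) + worst_case P x"
    unfolding worst_case_def by (intro add_left_mono SUP_upper \<xi>)
  finally show ?thesis .
qed

lemma reaches_ubar_pos:
  assumes "standing_assumptions P" and "reaches P A loc s"
  shows "0 < ubar s"
  using assms(2)
proof (induction rule: reaches.induct)
  case (call_oracle s \<xi>)
  then show ?case
    using worst_case_pos[OF assms(1) reaches_feasible[OF call_oracle.hyps(1)]] by simp
qed simp_all

text \<open>At \<open>Step1\<close> the master problem of index \<open>iter s\<close> is still to be
  solved, hence the half-open range. After an exploitation step this range is empty, so shrinking
  the gaps does no harm; initially both sides are 0.\<close>

lemma reaches_chain:
  assumes "valid_params A" and "reaches P A loc s"
  shows "lidx s \<le> iter s"
    and "loc = Step1 \<Longrightarrow>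
      lbar s \<le> lrec s (lidx s) * (\<Prod>k=lidx s..<iter s. 1 / (1 - mp_gap s k))"
    and "loc \<in> {Step2, Step3, Step4} \<Longrightarrow> urec s (iter s) = lbar s \<and>
      lbar s \<le> lrec s (lidx s) * (\<Prod>k=lidx s..iter s. 1 / (1 - mp_gap s k))"
  using assms(2)
proof (induction rule: reaches.induct)
  case (solve_master s x \<delta> Uj Lj)
  let ?g = "mp_gap s (iter s)" and ?l = "lidx s" and ?j = "iter s"
  have g: "0 < 1 - ?g"
    using reaches_mp_gap[OF assms(1) solve_master.hyps(1), of ?j] by simp
  have "Uj * (1 - ?g) \<le> Lj"
    using solve_master.hyps(6) by (simp add: algebra_simps)
  then have U: "Uj \<le> Lj * (1 / (1 - ?g))"
    using g by (simp add: pos_le_divide_eq)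
  {
    case 1
    show ?case using solve_master.IH(1) by simp
  next
    case 2
    then show ?case by simp
  next
    case 3
    show ?case
    proof (cases "lbar s < Lj \<or> ?l = ?j")
      \<comment> \<open>Either way the updated \<open>lidx\<close> is \<open>iter s\<close>: it has
        just been set, or an exploitation step had returned there and \<open>Lj\<close> overwrites
        the old bound. The product is a single factor.\<close>
      case True
      then show ?thesis using U by auto
    next
      case False
      then have "Lj = lbar s" and lj: "?l < ?j"
        using solve_master.hyps(4) solve_master.IH(1) by auto
      have "Uj \<le> Lj * (1 / (1 - ?g))" by (rule U)
      also have "\<dots> \<le> lrec s ?l * (\<Prod>k=?l..<?j. 1 / (1 - mp_gap s k)) * (1 / (1 - ?g))"
        using solve_master.IH(2) \<open>Lj = lbar s\<close> g by (intro mult_right_mono) auto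
      also have "\<dots> = lrec s ?l * (\<Prod>k=?l..?j. 1 / (1 - mp_gap s k))"
        using lj by (simp add: prod.last_plus mult_ac del: prod_dividef)
      finally show ?thesis using False lj by (simp del: prod_dividef)
    qed
  }
next
  case (add_scenario s)
  {
    case 1
    show ?case using add_scenario.IH(1) by simp
  next
    case 2
    show ?case using add_scenario.IH(3) by (simp add: atLeastLessThanSuc_atLeastAtMost)
  next
    case 3
    then show ?case by simp
  }
qed simp_all

theorem proposition2:
  fixes P :: "('n::finite, 'm::finite, 'l::finite, 'r::finite) problem"
    and A :: params
    and s :: "('n, 'l) state"
  assumes "standing_assumptions P"
    and "valid_params A"
    and "reaches P A Step3 s"
    and "actual_gap s \<ge> ereal (tol A)"
    and "inexact_gap s < ereal (inex_tol A)"
  shows "actual_gap s \<le>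
    ereal (1 / (1 - inex_tol A) * (\<Prod>k=lidx s..iter s. 1 / (1 - mp_gap s k)) - 1)"
proof -
  let ?L = "lrec s (lidx s)" and ?U = "urec s (iter s)" and ?e = "inex_tol A"
  let ?p = "\<Prod>k=lidx s..iter s. 1 / (1 - mp_gap s k)"
  have e: "0 < ?e" "?e < tol A / (1 + tol A)" and "0 \<le> tol A"
    using assms(2) by (auto simp: valid_params_def)
  moreover have "tol A / (1 + tol A) < 1" using \<open>0 \<le> tol A\<close> by simp
  \<comment> \<open>With \<open>tol A = 0\<close> no value of \<open>?e\<close> would be
    admissible.\<close>
  ultimately have e1: "?e < 1" and tol: "0 < tol A"
    by (linarith, cases "tol A = 0") auto
  have "0 < ubar s" by (rule reaches_ubar_pos[OF assms(1,3)])
  \<comment> \<open>In \<open>ereal\<close> the quotient \<open>\<infinity> / \<infinity>\<close> is \<open>0\<close>, so a positive gap forces a finite upper bound.\<close>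
  moreover have "ubar s \<noteq> \<infinity>"
    using assms(4) tol by (auto simp: actual_gap_def)
  ultimately obtain u where u: "ubar s = ereal u" "0 < u"
    by (cases "ubar s") auto
  have gap: "actual_gap s = ereal ((u - ?L) / u)" and "inexact_gap s = ereal ((u - ?U) / u)"
    using u by (simp_all add: actual_gap_def inexact_gap_def)
  then have "(u - ?U) / u < ?e" using assms(5) by simp
  then have uU: "u * (1 - ?e) < ?U"
    using u(2) by (simp add: pos_divide_less_eq algebra_simps)
  moreover have UL: "?U \<le> ?L * ?p"
    using reaches_chain(3)[OF assms(2,3)] by simp
  moreover have p: "0 < ?p"
    using reaches_mp_gap[OF assms(2,3)] by (intro prod_pos) simp
  moreover have "0 < u * (1 - ?e)" using u(2) e1 by simp
  \<comment> \<open>The run may start with \<open>lrec s 0 = 0\<close>; positivity comes from 0 < u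
    * (1 - ?e) < ?U <= ?L * ?p.\<close>
  ultimately have L: "0 < ?L"
    by (meson less_le_trans less_trans zero_less_mult_pos2)
  have "u * (1 - ?e) \<le> ?L * ?p" using uU UL by linarith
  then have "u / ?L \<le> 1 / (1 - ?e) * ?p"
    using L e1 by (simp add: field_simps del: prod_dividef)
  moreover have "(u - ?L) / u \<le> u / ?L - 1"
  proof -
    \<comment> \<open>The claim amounts to u / ?L + ?L / u >= 2.\<close>
    have "0 \<le> (u - ?L)\<^sup>2 / (u * ?L)" using u(2) L by simp
    also have "\<dots> = (u / ?L - 1) - (u - ?L) / u"
      using u(2) L by (simp add: field_simps power2_eq_square)
    finally show ?thesis by simp
  qed
  ultimately show ?thesis unfolding gap by simp
qed

end
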